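(* Let $G$ be a Hurwitz $C$-group, let $\nu:G\to\mathbb F_1$ be the natural $C$-homomorphism onto the free group of rank one, and let $N=\ker\nu$. Then the group $N$ is finitely presented.
   Context: $C$-groups. A $C$-group is a group $G$ given by a finite presentation of the form $$G_W=\langle x_1,\dots,x_m\mid x_i=w_{i,j,k}^{-1}x_jw_{i,j,k},\ (i,j,k)\in J\rangle,$$ where $m$ is a positive integer, $J=\{(i,j,k)\in\mathbb Z^3\mid 1\le i,j\le m,\ 1\le k\le h(i,j)\}$ for some function $h:\{1,\dots,m\}^2\to\mathbb Z$, and $W=\{w_{i,j,k}\mid (i,j,k)\in J\}$ is a set of words in the free group $\mathbb F_m$ on $x_1,\dots,x_m$ (the words $w_{i,j,k}$ may coincide for distinct indices). The images of $x_1,\dots,x_m$ in $G_W$ and all their conjugates are called the $C$-generators of $G_W$. A homomorphism of $C$-groups is a $C$-homomorphism if it sends $C$-generators to $C$-generators; $C$-groups are considered up to $C$-isomorphism. The free group $\mathbb F_1=\langle x\mid\emptyset\rangle\cong\mathbb Z$ is a $C$-group with $C$-generator $x$, and the natural $C$-homomorphism $\nu:G\to\mathbb F_1$ is the homomorphism sending every $C$-generator of $G$ to $x$. A Hurwitz $C$-group is a $C$-group $G$ which, for some $m$, possesses (up to $C$-isomorphism) a finite presentation of the form $\langle x_1,\dots,x_m\mid x_i=w_{i,j,k}^{-1}x_jw_{i,j,k},\ (i,j,k)\in J\rangle$ (with $J$ a finite index set of the form $\{(i,j,k)\in\mathbb Z^3\mid 1\le i,j\le m,\ 1\le k\le h(i,j)\}$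 for some function $h:\{1,\dots,m\}^2\to\mathbb Z$, and $w_{i,j,k}$ words in the free group $\mathbb F_m$ on $x_1,\dots,x_m$) with generators $x_1,\dots,x_m$ such that the element $x_1x_2\cdots x_m$ belongs to the center of $G$. *)

theory Defs
  imports "HOL-Algebra.Coset"
begin

section \<open>Free groups and finite presentations\<close>

text \<open>The letter \<open>(a, True)\<close> stands for the generator \<open>a\<close> and \<open>(a, False)\<close> for its inverse.\<close>

type_synonym 'a word = "('a \<times> bool) list"

inductive_set free_equiv :: "'a set \<Rightarrow> ('a word \<times> 'a word) set" for X where
  refl: "u \<in> lists (X \<times> UNIV) \<Longrightarrow> (u, u) \<in> free_equiv X"
| sym: "(u, v) \<in> free_equiv X \<Longrightarrow> (v, u) \<in> free_equiv X"
| trans: "(u, v) \<in> free_equiv X \<Longrightarrow> (v, w) \<in> free_equiv X \<Longrightarrow> (u, w) \<in> free_equiv X"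
| cancel: "u \<in> lists (X \<times> UNIV) \<Longrightarrow> v \<in> lists (X \<times> UNIV) \<Longrightarrow> a \<in> X \<Longrightarrow>
    (u @ [(a, e), (a, \<not> e)] @ v, u @ v) \<in> free_equiv X"

definition free_group :: "'a set \<Rightarrow> 'a word set monoid" where
  "free_group X =
    \<lparr>carrier = lists (X \<times> UNIV) // free_equiv X,
     mult = (\<lambda>A B. \<Union>a\<in>A. \<Union>b\<in>B. free_equiv X `` {a @ b}),
     one = free_equiv X `` {[]}\<rparr>"

definition free_gen :: "'a set \<Rightarrow> 'a \<Rightarrow> 'a word set" where
  "free_gen X a = free_equiv X `` {[(a, True)]}"

definition normal_closure :: "('a, 'b) monoid_scheme \<Rightarrow> 'a set \<Rightarrow> 'a set" where
  "normal_closure G R = \<Inter>{N. N \<lhd> G \<and> R \<subseteq> N}"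

definition presented_group :: "'a set \<Rightarrow> 'a word set set \<Rightarrow> 'a word set set monoid" where
  "presented_group X R = free_group X Mod normal_closure (free_group X) R"

definition presented_gen :: "'a set \<Rightarrow> 'a word set set \<Rightarrow> 'a \<Rightarrow> 'a word set set" where
  "presented_gen X R a = normal_closure (free_group X) R #>\<^bsub>free_group X\<^esub> free_gen X a"

definition finitely_presented :: "('a, 'b) monoid_scheme \<Rightarrow> bool" where
  "finitely_presented G \<longleftrightarrow> group G \<and>
    (\<exists>(n::nat) R. finite R \<and> R \<subseteq> carrier (free_group {1..n}) \<and> presented_group {1..n} R \<cong> G)"

lemma free_equiv_lists:
  "(u, v) \<in> free_equiv X \<Longrightarrow> u \<in> lists (X \<times> UNIV) \<and> v \<in> lists (X \<times> UNIV)"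
  by (induction rule: free_equiv.induct) auto

lemma equiv_free_equiv: "equiv (lists (X \<times> UNIV)) (free_equiv X)"
  by (intro equivI refl_onI symI transI)
     (auto intro: free_equiv.intros dest: free_equiv_lists)

lemma free_equiv_append:
  assumes "(u, u') \<in> free_equiv X" "(v, v') \<in> free_equiv X"
  shows "(u @ v, u' @ v') \<in> free_equiv X"
proof -
  have 1: "(u @ w, u' @ w) \<in> free_equiv X" if "w \<in> lists (X \<times> UNIV)" for w
    using assms(1)
  proof (induction rule: free_equiv.induct)
    case (refl u)
    then show ?case using that by (intro free_equiv.refl) auto
  next
    case (cancel u v a e)
    then show ?case using free_equiv.cancel[of u X "v @ w" a e] that by simp
  qed (use that in \<open>auto intro: free_equiv.intros\<close>)
  have 2: "(w @ v, w @ v') \<in> free_equiv X" if "w \<in> lists (X \<times> UNIV)" for w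
    using assms(2)
  proof (induction rule: free_equiv.induct)
    case (refl u)
    then show ?case using that by (intro free_equiv.refl) auto
  next
    case (cancel u v a e)
    then show ?case using free_equiv.cancel[of "w @ u" X v a e] that by simp
  qed (use that in \<open>auto intro: free_equiv.intros\<close>)
  show ?thesis
    using 1[of v] 2[of u'] assms free_equiv_lists free_equiv.trans by metis
qed

lemma free_group_mult:
  assumes "u \<in> lists (X \<times> UNIV)" "v \<in> lists (X \<times> UNIV)"
  shows "free_equiv X `` {u} \<otimes>\<^bsub>free_group X\<^esub> free_equiv X `` {v} = free_equiv X `` {u @ v}"
proof -
  have "(\<Union>a\<in>free_equiv X `` {u}. \<Union>b\<in>free_equiv X `` {v}. free_equiv X `` {a @ b})
      = free_equiv X `` {u @ v}"
  proof (rule UN_equiv_class2[OF equiv_free_equiv equiv_free_equiv _ assms])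
    show "congruent2 (free_equiv X) (free_equiv X) (\<lambda>a b. free_equiv X `` {a @ b})"
      by (intro congruent2I' equiv_class_eq[OF equiv_free_equiv] free_equiv_append)
  qed
  then show ?thesis by (simp add: free_group_def)
qed

lemma group_free_group: "group (free_group X)"
proof (rule groupI)
  let ?L = "lists (X \<times> (UNIV :: bool set))"
  have carrierE: "\<exists>u\<in>?L. x = free_equiv X `` {u}" if "x \<in> carrier (free_group X)" for x
    using that by (auto simp: free_group_def quotient_def)
  have one: "\<one>\<^bsub>free_group X\<^esub> = free_equiv X `` {[]}"
    by (simp add: free_group_def)
  have carrierI: "free_equiv X `` {u} \<in> carrier (free_group X)" if "u \<in> ?L" for u
    using that by (auto simp: free_group_def quotient_def)
  show "\<one>\<^bsub>free_group X\<^esub> \<in> carrier (free_group X)"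
    by (simp only: one carrierI lists.Nil)
  fix x assume "x \<in> carrier (free_group X)"
  then obtain u where u: "u \<in> ?L" "x = free_equiv X `` {u}" using carrierE by blast
  show "\<one>\<^bsub>free_group X\<^esub> \<otimes>\<^bsub>free_group X\<^esub> x = x"
    using u free_group_mult[of "[]" X u] by (simp add: one)
  have inverse: "\<exists>v\<in>?L. (v @ u, []) \<in> free_equiv X" using u(1)
  proof (induction u)
    case Nil
    then show ?case by (auto intro: free_equiv.refl)
  next
    case (Cons p u)
    then obtain v where v: "v \<in> ?L" "(v @ u, []) \<in> free_equiv X" by auto
    obtain a e where p: "p = (a, e)" "a \<in> X" using Cons by (cases p) auto
    have "(v @ [(a, \<not> e), (a, e)] @ u, v @ u) \<in> free_equiv X"
      using free_equiv.cancel[of v X u a "\<not> e"] v p Cons by simp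
    with v have "((v @ [(a, \<not> e)]) @ p # u, []) \<in> free_equiv X"
      using free_equiv.trans p by fastforce
    then show ?case using v p by (intro bexI[of _ "v @ [(a, \<not> e)]"]) auto
  qed
  show "\<exists>y\<in>carrier (free_group X). y \<otimes>\<^bsub>free_group X\<^esub> x = \<one>\<^bsub>free_group X\<^esub>"
    using inverse u carrierI free_group_mult[of _ X u]
    by (metis one equiv_class_eq[OF equiv_free_equiv])
  fix y assume "y \<in> carrier (free_group X)"
  then obtain v where v: "v \<in> ?L" "y = free_equiv X `` {v}" using carrierE by blast
  show "x \<otimes>\<^bsub>free_group X\<^esub> y \<in> carrier (free_group X)"
    using u v carrierI[of "u @ v"] by (simp add: free_group_mult)
  fix z assume "z \<in> carrier (free_group X)"
  then obtain w where w: "w \<in> ?L" "z = free_equiv X `` {w}" using carrierE by blast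
  show "x \<otimes>\<^bsub>free_group X\<^esub> y \<otimes>\<^bsub>free_group X\<^esub> z
      = x \<otimes>\<^bsub>free_group X\<^esub> (y \<otimes>\<^bsub>free_group X\<^esub> z)"
    using u v w free_group_mult[of u X "v @ w"] free_group_mult[of "u @ v" X w]
    by (simp add: free_group_mult)
qed


section \<open>C-groups\<close>

definition C_index :: "nat \<Rightarrow> (nat \<times> nat \<Rightarrow> int) \<Rightarrow> (nat \<times> nat \<times> int) set" where
  "C_index m h = {(i, j, k). i \<in> {1..m} \<and> j \<in> {1..m} \<and> 1 \<le> k \<and> k \<le> h (i, j)}"

definition C_presentation ::
    "nat \<Rightarrow> (nat \<times> nat \<Rightarrow> int) \<Rightarrow> (nat \<times> nat \<times> int \<Rightarrow> nat word set) \<Rightarrow> bool" where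
  "C_presentation m h w \<longleftrightarrow> 1 \<le> m \<and> (\<forall>p\<in>C_index m h. w p \<in> carrier (free_group {1..m}))"

text \<open>The relation \<open>x\<^sub>i = w\<inverse> x\<^sub>j w\<close> is encoded by the relator \<open>x\<^sub>i\<inverse> (w\<inverse> x\<^sub>j w)\<close>.\<close>

definition C_relators ::
    "nat \<Rightarrow> (nat \<times> nat \<Rightarrow> int) \<Rightarrow> (nat \<times> nat \<times> int \<Rightarrow> nat word set) \<Rightarrow> nat word set set" where
  "C_relators m h w =
    (let F = free_group {1..m}; x = free_gen {1..m} in
      {inv\<^bsub>F\<^esub> (x i) \<otimes>\<^bsub>F\<^esub> (inv\<^bsub>F\<^esub> (w (i, j, k)) \<otimes>\<^bsub>F\<^esub> x j \<otimes>\<^bsub>F\<^esub> w (i, j, k)) |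
        i j k. (i, j, k) \<in> C_index m h})"

definition C_presented_group ::
    "nat \<Rightarrow> (nat \<times> nat \<Rightarrow> int) \<Rightarrow> (nat \<times> nat \<times> int \<Rightarrow> nat word set) \<Rightarrow> nat word set set monoid" where
  "C_presented_group m h w = presented_group {1..m} (C_relators m h w)"

definition C_presented_gen ::
    "nat \<Rightarrow> (nat \<times> nat \<Rightarrow> int) \<Rightarrow> (nat \<times> nat \<times> int \<Rightarrow> nat word set) \<Rightarrow> nat \<Rightarrow> nat word set set" where
  "C_presented_gen m h w = presented_gen {1..m} (C_relators m h w)"

definition conjugates :: "('a, 'b) monoid_scheme \<Rightarrow> 'a set \<Rightarrow> 'a set" where
  "conjugates G S = {g \<otimes>\<^bsub>G\<^esub> x \<otimes>\<^bsub>G\<^esub> inv\<^bsub>G\<^esub> g | g x. g \<in> carrier G \<and> x \<in> S}"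

definition C_presented_Cgens ::
    "nat \<Rightarrow> (nat \<times> nat \<Rightarrow> int) \<Rightarrow> (nat \<times> nat \<times> int \<Rightarrow> nat word set) \<Rightarrow> nat word set set set" where
  "C_presented_Cgens m h w =
    conjugates (C_presented_group m h w) (C_presented_gen m h w ` {1..m})"

text \<open>
  A C-group is a pair of a group \<open>G\<close> and its set \<open>C\<close> of C-generators; it is considered up to
  isomorphisms that are C-homomorphisms in both directions.
\<close>

definition C_hom ::
    "('a, 'c) monoid_scheme \<Rightarrow> 'a set \<Rightarrow> ('b, 'd) monoid_scheme \<Rightarrow> 'b set \<Rightarrow> ('a \<Rightarrow> 'b) set" where
  "C_hom G C H D = {f \<in> hom G H. f ` C \<subseteq> D}"

definition C_iso ::
    "('a, 'c) monoid_scheme \<Rightarrow> 'a set \<Rightarrow> ('b, 'd) monoid_scheme \<Rightarrow> 'b set \<Rightarrow> ('a \<Rightarrow> 'b) set" where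
  "C_iso G C H D =
    {f \<in> iso G H. f \<in> C_hom G C H D \<and> inv_into (carrier G) f \<in> C_hom H D G C}"

definition has_C_presentation ::
    "('a, 'b) monoid_scheme \<Rightarrow> 'a set \<Rightarrow>
      nat \<Rightarrow> (nat \<times> nat \<Rightarrow> int) \<Rightarrow> (nat \<times> nat \<times> int \<Rightarrow> nat word set) \<Rightarrow> bool" where
  "has_C_presentation G C m h w \<longleftrightarrow> C_presentation m h w \<and>
    C_iso (C_presented_group m h w) (C_presented_Cgens m h w) G C \<noteq> {}"

definition C_group :: "('a, 'b) monoid_scheme \<Rightarrow> 'a set \<Rightarrow> bool" where
  "C_group G C \<longleftrightarrow> group G \<and> C \<subseteq> carrier G \<and> (\<exists>m h w. has_C_presentation G C m h w)"

definition group_center :: "('a, 'b) monoid_scheme \<Rightarrow> 'a set" where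
  "group_center G = {z \<in> carrier G. \<forall>g\<in>carrier G. z \<otimes>\<^bsub>G\<^esub> g = g \<otimes>\<^bsub>G\<^esub> z}"

definition ordered_prod :: "('a, 'b) monoid_scheme \<Rightarrow> 'a list \<Rightarrow> 'a" where
  "ordered_prod G xs = foldr (\<otimes>\<^bsub>G\<^esub>) xs \<one>\<^bsub>G\<^esub>"

definition Hurwitz_C_group :: "('a, 'b) monoid_scheme \<Rightarrow> 'a set \<Rightarrow> bool" where
  "Hurwitz_C_group G C \<longleftrightarrow> C_group G C \<and>
    (\<exists>m h w. has_C_presentation G C m h w \<and>
      ordered_prod (C_presented_group m h w) (map (C_presented_gen m h w) [1..<Suc m])
        \<in> group_center (C_presented_group m h w))"

abbreviation F1 :: "nat word set monoid" where
  "F1 \<equiv> free_group {1}"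

text \<open>
  The values of the natural C-homomorphism are only determined on the carrier of \<open>G\<close>,
  so it is described by a predicate.
\<close>

definition natural_C_hom ::
    "('a, 'b) monoid_scheme \<Rightarrow> 'a set \<Rightarrow> ('a \<Rightarrow> nat word set) \<Rightarrow> bool" where
  "natural_C_hom G C \<nu> \<longleftrightarrow> \<nu> \<in> hom G F1 \<and> (\<forall>c\<in>C. \<nu> c = free_gen {1} 1)"

section \<open>Existence of the natural C-homomorphism\<close>

lemma free_gen_carrier: "a \<in> X \<Longrightarrow> free_gen X a \<in> carrier (free_group X)"
  by (auto simp: free_gen_def free_group_def quotient_def)

lemma normal_normal_closure:
  assumes "group G" "R \<subseteq> carrier G"
  shows "normal_closure G R \<lhd> G"
proof -
  interpret group G by fact
  have "carrier G \<lhd> G" by (simp add: normal_inv_iff subgroup_self)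
  then have ne: "{N. N \<lhd> G \<and> R \<subseteq> N} \<noteq> {}" using assms by blast
  have "subgroup (normal_closure G R) G"
    unfolding normal_closure_def
    by (rule subgroups_Inter[OF _ ne]) (auto dest: normal_imp_subgroup)
  then show ?thesis
    by (auto simp: normal_inv_iff normal_closure_def)
qed

context
  fixes H :: "('h, 'd) monoid_scheme" and X :: "'a set" and c :: 'h
  assumes H: "group H" and c: "c \<in> carrier H"
begin

interpretation group H by (rule H)

definition const_eval :: "'a word \<Rightarrow> 'h" where
  "const_eval u = foldr (\<lambda>p y. (if snd p then c else inv\<^bsub>H\<^esub> c) \<otimes>\<^bsub>H\<^esub> y) u \<one>\<^bsub>H\<^esub>"

lemma const_eval_closed [simp]: "const_eval u \<in> carrier H"
  by (induction u) (auto simp: const_eval_def c)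

lemma const_eval_Cons: "const_eval (p # u) = (if snd p then c else inv\<^bsub>H\<^esub> c) \<otimes>\<^bsub>H\<^esub> const_eval u"
  by (simp add: const_eval_def)

lemma const_eval_Nil: "const_eval [] = \<one>\<^bsub>H\<^esub>"
  by (simp add: const_eval_def)

lemma const_eval_append: "const_eval (u @ v) = const_eval u \<otimes>\<^bsub>H\<^esub> const_eval v"
  by (induction u) (auto simp: const_eval_Cons const_eval_Nil m_assoc c)

lemma const_eval_commute: "const_eval u \<otimes>\<^bsub>H\<^esub> c = c \<otimes>\<^bsub>H\<^esub> const_eval u"
proof (induction u)
  case Nil
  then show ?case by (simp add: const_eval_Nil c)
next
  case (Cons p u)
  have "inv\<^bsub>H\<^esub> c \<otimes>\<^bsub>H\<^esub> (const_eval u \<otimes>\<^bsub>H\<^esub> c) = c \<otimes>\<^bsub>H\<^esub> (inv\<^bsub>H\<^esub> c \<otimes>\<^bsub>H\<^esub> const_eval u)"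
    using Cons c by (simp flip: m_assoc)
  with Cons show ?case by (simp add: const_eval_Cons c m_assoc)
qed

lemma const_eval_equiv: "(u, v) \<in> free_equiv X \<Longrightarrow> const_eval u = const_eval v"
proof (induction rule: free_equiv.induct)
  case (cancel u v a e)
  then show ?case using c by (cases e) (simp_all add: const_eval_append const_eval_Cons flip: m_assoc)
qed auto

definition const_hom :: "'a word set \<Rightarrow> 'h" where
  "const_hom A = const_eval (SOME u. u \<in> A)"

lemma const_hom_class: "u \<in> lists (X \<times> UNIV) \<Longrightarrow> const_hom (free_equiv X `` {u}) = const_eval u"
  unfolding const_hom_def
  by (rule someI2[of _ u]) (auto intro: free_equiv.refl simp: const_eval_equiv)

lemma carrier_free_groupE:
  assumes "A \<in> carrier (free_group X)"
  obtains u where "u \<in> lists (X \<times> UNIV)" "A = free_equiv X `` {u}"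
  using assms by (auto simp: free_group_def quotient_def)

lemma const_hom_hom: "const_hom \<in> hom (free_group X) H"
proof (rule homI)
  fix A B assume A: "A \<in> carrier (free_group X)" and B: "B \<in> carrier (free_group X)"
  show "const_hom A \<in> carrier H" by (simp add: const_hom_def)
  obtain u v where "u \<in> lists (X \<times> UNIV)" "A = free_equiv X `` {u}"
    "v \<in> lists (X \<times> UNIV)" "B = free_equiv X `` {v}"
    using A B by (metis carrier_free_groupE)
  then show "const_hom (A \<otimes>\<^bsub>free_group X\<^esub> B) = const_hom A \<otimes>\<^bsub>H\<^esub> const_hom B"
    using const_hom_class[of "u @ v"] by (simp add: free_group_mult const_hom_class const_eval_append)
qed

lemma const_hom_commute: "const_hom A \<otimes>\<^bsub>H\<^esub> c = c \<otimes>\<^bsub>H\<^esub> const_hom A"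
  by (simp add: const_hom_def const_eval_commute)

lemma const_hom_closed [simp]: "const_hom A \<in> carrier H"
  by (simp add: const_hom_def)

lemma const_hom_gen: "a \<in> X \<Longrightarrow> const_hom (free_gen X a) = c"
  using const_hom_class[of "[(a, True)]"] by (simp add: free_gen_def const_eval_Cons const_eval_Nil c)

end

lemma C_relators_carrier:
  assumes "C_presentation m h w"
  shows "C_relators m h w \<subseteq> carrier (free_group {1..m})"
proof -
  interpret group "free_group {1..m}" by (rule group_free_group)
  show ?thesis
  proof
    fix r assume "r \<in> C_relators m h w"
    then obtain i j k where ijk: "(i, j, k) \<in> C_index m h"
      and r: "r = inv\<^bsub>free_group {1..m}\<^esub> (free_gen {1..m} i) \<otimes>\<^bsub>free_group {1..m}\<^esub>
        (inv\<^bsub>free_group {1..m}\<^esub> (w (i, j, k)) \<otimes>\<^bsub>free_group {1..m}\<^esub> free_gen {1..m} j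
          \<otimes>\<^bsub>free_group {1..m}\<^esub> w (i, j, k))"
      unfolding C_relators_def Let_def by blast
    moreover have "w (i, j, k) \<in> carrier (free_group {1..m})"
      using assms ijk unfolding C_presentation_def by blast
    moreover have "free_gen {1..m} i \<in> carrier (free_group {1..m})"
      "free_gen {1..m} j \<in> carrier (free_group {1..m})"
      using ijk by (auto simp: C_index_def intro!: free_gen_carrier)
    ultimately show "r \<in> carrier (free_group {1..m})"
      by (simp del: One_nat_def)
  qed
qed

lemma natural_C_hom_exists:
  assumes "C_group G C"
  shows "\<exists>\<nu>. natural_C_hom G C \<nu>"
proof -
  from assms have "\<exists>m h w. has_C_presentation G C m h w" by (simp only: C_group_def)
  then obtain m h w where pres: "has_C_presentation G C m h w" by (elim exE)
  then have P: "C_presentation m h w" by (simp only: has_C_presentation_def)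
  from pres obtain f
    where f: "f \<in> C_iso (C_presented_group m h w) (C_presented_Cgens m h w) G C"
    unfolding has_C_presentation_def by (metis ex_in_conv)
  define F where "F = free_group {1..m}"
  define R where "R = C_relators m h w"
  define c :: "nat word set" where "c = free_gen {1} 1"
  define N where "N = normal_closure F R"
  interpret F: group F unfolding F_def by (rule group_free_group)
  interpret H: group F1 by (rule group_free_group)
  have c: "c \<in> carrier F1" unfolding c_def by (rule free_gen_carrier) simp
  define \<phi> :: "nat word set \<Rightarrow> nat word set" where "\<phi> = const_hom F1 c"
  have hom: "\<phi> \<in> hom F F1" unfolding \<phi>_def F_def by (rule const_hom_hom[OF H.is_group c])
  interpret \<phi>: group_hom F F1 \<phi> by unfold_locales (rule hom)
  have comm: "\<phi> A \<otimes>\<^bsub>F1\<^esub> c = c \<otimes>\<^bsub>F1\<^esub> \<phi> A" for A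
    unfolding \<phi>_def by (rule const_hom_commute[OF H.is_group c])
  have gen: "\<phi> (free_gen {1..m} i) = c" if "i \<in> {1..m}" for i
    unfolding \<phi>_def by (rule const_hom_gen[OF H.is_group c that])
  have Rc: "R \<subseteq> carrier F" unfolding R_def F_def by (rule C_relators_carrier[OF P])
  have N: "N \<lhd> F" unfolding N_def by (rule normal_normal_closure[OF F.is_group Rc])
  have "\<phi> r = \<one>\<^bsub>F1\<^esub>" if r: "r \<in> R" for r
  proof -
    obtain i j k where ijk: "(i, j, k) \<in> C_index m h"
      and r: "r = inv\<^bsub>F\<^esub> (free_gen {1..m} i) \<otimes>\<^bsub>F\<^esub> (inv\<^bsub>F\<^esub> (w (i, j, k)) \<otimes>\<^bsub>F\<^esub> free_gen {1..m} j \<otimes>\<^bsub>F\<^esub> w (i, j, k))"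
      using r unfolding R_def C_relators_def Let_def F_def by auto
    have ij: "i \<in> {1..m}" "j \<in> {1..m}" using ijk by (auto simp: C_index_def)
    have wc: "w (i, j, k) \<in> carrier F" using P ijk by (auto simp: C_presentation_def F_def)
    have gc: "free_gen {1..m} i \<in> carrier F" "free_gen {1..m} j \<in> carrier F"
      unfolding F_def using ij by (auto intro!: free_gen_carrier)
    have "\<phi> r = inv\<^bsub>F1\<^esub> c \<otimes>\<^bsub>F1\<^esub> (inv\<^bsub>F1\<^esub> (\<phi> (w (i, j, k))) \<otimes>\<^bsub>F1\<^esub> (c \<otimes>\<^bsub>F1\<^esub> \<phi> (w (i, j, k))))"
      unfolding r using wc gc c gen[OF ij(1)] gen[OF ij(2)] by (simp add: H.m_assoc del: One_nat_def)
    also have "\<dots> = inv\<^bsub>F1\<^esub> c \<otimes>\<^bsub>F1\<^esub> (inv\<^bsub>F1\<^esub> (\<phi> (w (i, j, k))) \<otimes>\<^bsub>F1\<^esub> \<phi> (w (i, j, k)) \<otimes>\<^bsub>F1\<^esub> c)"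
      using wc c by (simp only: comm[symmetric] H.m_assoc H.inv_closed \<phi>.hom_closed)
    also have "\<dots> = \<one>\<^bsub>F1\<^esub>"
      using wc c by (simp only: H.l_inv H.l_one \<phi>.hom_closed)
    finally show ?thesis .
  qed
  then have "R \<subseteq> kernel F F1 \<phi>" using Rc by (auto simp: kernel_def)
  then have Nk: "N \<subseteq> kernel F F1 \<phi>"
    unfolding N_def normal_closure_def using \<phi>.normal_kernel by blast
  have "\<phi> x = \<phi> y" if "x \<in> carrier F" "y \<in> carrier F" "N #>\<^bsub>F\<^esub> x = N #>\<^bsub>F\<^esub> y" for x y
  proof -
    have "x \<in> N #>\<^bsub>F\<^esub> y" using that F.rcos_self[OF that(1) normal_imp_subgroup[OF N]] by simp
    then obtain n where n: "n \<in> N" "x = n \<otimes>\<^bsub>F\<^esub> y" by (auto simp: r_coset_def)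
    with Nk have "n \<in> carrier F" "\<phi> n = \<one>\<^bsub>F1\<^esub>" by (auto simp: kernel_def)
    then show ?thesis using n that by (simp del: One_nat_def)
  qed
  then obtain g where g: "g \<in> hom (F Mod N) F1" "\<And>x. x \<in> carrier F \<Longrightarrow> g (N #>\<^bsub>F\<^esub> x) = \<phi> x"
    using FactGroup_universal[OF hom N] by metis
  have PG: "C_presented_group m h w = F Mod N"
    by (simp add: C_presented_group_def presented_group_def F_def N_def R_def)
  interpret Q: group "F Mod N" by (rule normal.factorgroup_is_group[OF N])
  interpret g: group_hom "F Mod N" F1 g by unfold_locales (rule g(1))
  have gc: "g y = c" if "y \<in> C_presented_Cgens m h w" for y
  proof -
    have CP: "C_presented_gen m h w i = N #>\<^bsub>F\<^esub> free_gen {1..m} i" for i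
      by (simp only: C_presented_gen_def presented_gen_def F_def N_def R_def)
    from that have "\<exists>z q. y = z \<otimes>\<^bsub>F Mod N\<^esub> q \<otimes>\<^bsub>F Mod N\<^esub> inv\<^bsub>F Mod N\<^esub> z \<and> z \<in> carrier (F Mod N) \<and>
        q \<in> C_presented_gen m h w ` {1..m}"
      by (simp only: C_presented_Cgens_def conjugates_def PG mem_Collect_eq)
    then obtain z q where y: "y = z \<otimes>\<^bsub>F Mod N\<^esub> q \<otimes>\<^bsub>F Mod N\<^esub> inv\<^bsub>F Mod N\<^esub> z"
      and zc: "z \<in> carrier (F Mod N)" and q: "q \<in> C_presented_gen m h w ` {1..m}"
      by (elim exE conjE)
    from q obtain i where i: "i \<in> {1..m}" and "q = C_presented_gen m h w i" by (rule imageE)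
    with y CP have "y = z \<otimes>\<^bsub>F Mod N\<^esub> (N #>\<^bsub>F\<^esub> free_gen {1..m} i) \<otimes>\<^bsub>F Mod N\<^esub> inv\<^bsub>F Mod N\<^esub> z"
      by (simp only:)
    note z = zc i this
    have fg: "free_gen {1..m} i \<in> carrier F"
      unfolding F_def using z by (auto intro!: free_gen_carrier)
    then have fgN: "N #>\<^bsub>F\<^esub> free_gen {1..m} i \<in> carrier (F Mod N)"
      by (simp add: carrier_FactGroup)
    obtain x where x: "x \<in> carrier F" "z = N #>\<^bsub>F\<^esub> x" using z by (auto simp: carrier_FactGroup)
    have "g y = g z \<otimes>\<^bsub>F1\<^esub> g (N #>\<^bsub>F\<^esub> free_gen {1..m} i) \<otimes>\<^bsub>F1\<^esub> inv\<^bsub>F1\<^esub> (g z)"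
      unfolding z(3) using z(1) fgN by (simp only: g.hom_mult g.hom_inv Q.m_closed Q.inv_closed)
    also have "\<dots> = \<phi> x \<otimes>\<^bsub>F1\<^esub> c \<otimes>\<^bsub>F1\<^esub> inv\<^bsub>F1\<^esub> (\<phi> x)"
      by (simp only: x(2) g(2)[OF x(1)] g(2)[OF fg] gen[OF z(2)])
    also have "\<dots> = c" unfolding comm using x c by (simp add: H.m_assoc del: One_nat_def)
    finally show ?thesis .
  qed
  define k where "k = inv_into (carrier (F Mod N)) f"
  have fi: "f \<in> iso (F Mod N) G" and "k \<in> C_hom G C (F Mod N) (C_presented_Cgens m h w)"
    using f unfolding C_iso_def PG k_def by auto
  then have k: "k \<in> hom G (F Mod N)" "\<And>x. x \<in> C \<Longrightarrow> k x \<in> C_presented_Cgens m h w"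
    unfolding C_hom_def by auto
  have "g \<circ> k \<in> hom G F1" by (rule hom_compose[OF k(1) g(1)])
  moreover have "(g \<circ> k) x = free_gen {1} 1" if "x \<in> C" for x
    using gc[OF k(2)[OF that]] by (simp only: o_apply c_def)
  ultimately have "natural_C_hom G C (g \<circ> k)"
    unfolding natural_C_hom_def by blast
  then show ?thesis by blast
qed
end

theory Submission
  imports Defs "HOL-Algebra.Elementary_Groups"
begin

text \<open>
  Let \<open>\<pi> : F \<rightarrow> G\<close> be the given presentation, \<open>z \<in> F\<close> the product of the generators and \<open>m\<close> its degree.
  As \<open>\<pi> z\<close> is central, \<open>N \<times> \<langle>\<pi> z\<rangle>\<close> is the subgroup of index \<open>m\<close> of elements whose degree is
  divisible by \<open>m\<close>, and \<open>N\<close> is its quotient by \<open>\<langle>\<pi> z\<rangle>\<close>. This gives a Reidemeister-Schreier type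
  presentation of \<open>N\<close>, with a generator \<open>a\<^sub>i\<^sub>k\<close> for each \<open>x\<^sub>i\<close> and each \<open>k\<close> modulo \<open>m\<close>, standing for
  \<open>p\<^sub>k x\<^sub>i p\<^sub>k\<^sub>+\<^sub>1\<inverse>\<close> where \<open>p\<^sub>k\<close> is an element of degree \<open>k\<close> that is periodic up to powers of \<open>z\<close>.

  Instead of rewriting words, \<open>F\<close> is mapped to the group of pairs of an \<open>m\<close>-periodic sequence in a group
  and an integer that acts by shifting, by \<open>x\<^sub>i \<mapsto> (k \<mapsto> a\<^sub>i\<^sub>k, 1)\<close>: the \<open>k\<close>-th entry of the image of a
  word is its rewriting from the coset \<open>k\<close>. With target the presented group, this map kills the
  relators of \<open>G\<close>, hence provides an inverse of the map from the presented group to \<open>N\<close>.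
\<close>

section \<open>Homomorphisms out of free and presented groups\<close>

lemma free_class_carrier: "u \<in> lists (X \<times> UNIV) \<Longrightarrow> free_equiv X `` {u} \<in> carrier (free_group X)"
  by (auto simp: free_group_def quotient_def)

lemma free_group_one: "\<one>\<^bsub>free_group X\<^esub> = free_equiv X `` {[]}"
  by (simp add: free_group_def)

lemma free_group_cases:
  assumes "A \<in> carrier (free_group X)"
  obtains u where "u \<in> lists (X \<times> UNIV)" "A = free_equiv X `` {u}"
  using assms by (auto simp: free_group_def quotient_def)

lemma inv_free_gen:
  assumes "a \<in> X"
  shows "inv\<^bsub>free_group X\<^esub> (free_gen X a) = free_equiv X `` {[(a, False)]}"
proof (rule group.inv_equality[OF group_free_group])
  have "([(a, False), (a, True)], []) \<in> free_equiv X"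
    using free_equiv.cancel[of "[]" X "[]" a False] assms by simp
  then show "free_equiv X `` {[(a, False)]} \<otimes>\<^bsub>free_group X\<^esub> free_gen X a = \<one>\<^bsub>free_group X\<^esub>"
    using assms equiv_class_eq[OF equiv_free_equiv]
    by (simp add: free_gen_def free_group_mult free_group_one)
qed (use assms in \<open>auto intro!: free_class_carrier free_gen_carrier\<close>)

lemma free_group_induct [consumes 1, case_names one gen mult inv]:
  assumes A: "A \<in> carrier (free_group X)"
    and one: "P \<one>\<^bsub>free_group X\<^esub>"
    and gen: "\<And>a. a \<in> X \<Longrightarrow> P (free_gen X a)"
    and mult: "\<And>A B. A \<in> carrier (free_group X) \<Longrightarrow> B \<in> carrier (free_group X) \<Longrightarrow> P A \<Longrightarrow> P B \<Longrightarrow>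
      P (A \<otimes>\<^bsub>free_group X\<^esub> B)"
    and inv: "\<And>A. A \<in> carrier (free_group X) \<Longrightarrow> P A \<Longrightarrow> P (inv\<^bsub>free_group X\<^esub> A)"
  shows "P A"
proof -
  have "P (free_equiv X `` {u})" if "u \<in> lists (X \<times> UNIV)" for u
    using that
  proof (induction u)
    case Nil
    then show ?case using one by (simp add: free_group_one)
  next
    case (Cons s u)
    obtain a e where s: "s = (a, e)" and a: "a \<in> X" using Cons by (cases s) auto
    have "P (free_equiv X `` {[s]})"
    proof (cases e)
      case True
      then show ?thesis using gen[OF a] by (simp add: free_gen_def s)
    next
      case False
      then show ?thesis
        using inv[OF free_gen_carrier[OF a] gen[OF a]] by (simp add: inv_free_gen a s)
    qed
    then have "P (free_equiv X `` {[s]} \<otimes>\<^bsub>free_group X\<^esub> free_equiv X `` {u})"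
      using Cons by (intro mult free_class_carrier) auto
    then show ?case using Cons by (simp add: free_group_mult)
  qed
  then show ?thesis using free_group_cases[OF A] by metis
qed

text \<open>Later identities for all elements of a free group are phrased as equalities of two
  homomorphisms, so that only the generators have to be checked and no word is ever
  rewritten.\<close>

lemma free_group_hom_eqI:
  assumes H: "group H" and f: "f \<in> hom (free_group X) H" and g: "g \<in> hom (free_group X) H"
    and eq: "\<And>a. a \<in> X \<Longrightarrow> f (free_gen X a) = g (free_gen X a)"
    and A: "A \<in> carrier (free_group X)"
  shows "f A = g A"
proof -
  interpret f: group_hom "free_group X" H f
    using group_free_group H f by (intro group_hom.intro group_hom_axioms.intro)
  interpret g: group_hom "free_group X" H g
    using group_free_group H g by (intro group_hom.intro group_hom_axioms.intro)
  show ?thesis using A by (induction rule: free_group_induct) (auto simp: eq)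
qed

definition word_eval :: "('h, 'd) monoid_scheme \<Rightarrow> ('a \<Rightarrow> 'h) \<Rightarrow> 'a word \<Rightarrow> 'h" where
  "word_eval H f u = foldr (\<lambda>(a, e) y. (if e then f a else inv\<^bsub>H\<^esub> (f a)) \<otimes>\<^bsub>H\<^esub> y) u \<one>\<^bsub>H\<^esub>"

text \<open>The chosen representative does not matter once \<open>f\<close> maps the generators into
  the carrier of \<open>H\<close>, because cancellation then preserves
  \<open>word_eval\<close>.\<close>

definition free_lift :: "('h, 'd) monoid_scheme \<Rightarrow> ('a \<Rightarrow> 'h) \<Rightarrow> 'a word set \<Rightarrow> 'h" where
  "free_lift H f A = word_eval H f (SOME u. u \<in> A)"

context
  fixes H :: "('h, 'd) monoid_scheme" and X :: "'a set" and f :: "'a \<Rightarrow> 'h"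
  assumes H: "group H" and f: "f \<in> X \<rightarrow> carrier H"
begin

interpretation group H by (rule H)

lemma word_eval_closed: "u \<in> lists (X \<times> UNIV) \<Longrightarrow> word_eval H f u \<in> carrier H"
  using f by (induction u) (auto simp: word_eval_def Pi_iff)

lemma word_eval_append:
  "u \<in> lists (X \<times> UNIV) \<Longrightarrow> v \<in> lists (X \<times> UNIV) \<Longrightarrow>
    word_eval H f (u @ v) = word_eval H f u \<otimes>\<^bsub>H\<^esub> word_eval H f v"
proof (induction u)
  case Nil
  then show ?case using word_eval_closed[of v] by (simp add: word_eval_def)
next
  case (Cons s u)
  obtain a e where s: "s = (a, e)" and a: "f a \<in> carrier H" using Cons f by (cases s) auto
  have "word_eval H f (s # w) = (if e then f a else inv\<^bsub>H\<^esub> (f a)) \<otimes>\<^bsub>H\<^esub> word_eval H f w" for w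
    by (simp add: word_eval_def s)
  then show ?case using Cons a word_eval_closed[of u] word_eval_closed[of v] by (auto simp: m_assoc)
qed

lemma word_eval_equiv: "(u, v) \<in> free_equiv X \<Longrightarrow> word_eval H f u = word_eval H f v"
proof (induction rule: free_equiv.induct)
  case (cancel u v a e)
  have "word_eval H f [(a, e), (a, \<not> e)] = \<one>\<^bsub>H\<^esub>"
    using f cancel by (cases e) (auto simp: word_eval_def Pi_iff)
  then show ?case
    using cancel word_eval_append[of "[(a, e), (a, \<not> e)]" v] word_eval_append[of u v]
      word_eval_append[of u "[(a, e), (a, \<not> e)] @ v"] word_eval_closed[of v] by simp
qed auto

lemma free_lift_class: "u \<in> lists (X \<times> UNIV) \<Longrightarrow> free_lift H f (free_equiv X `` {u}) = word_eval H f u"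
  unfolding free_lift_def
  by (rule someI2[of _ u]) (auto intro: free_equiv.refl simp: word_eval_equiv)

lemma free_lift_hom: "free_lift H f \<in> hom (free_group X) H"
proof (rule homI)
  fix A assume "A \<in> carrier (free_group X)"
  then show "free_lift H f A \<in> carrier H"
    by (metis free_group_cases free_lift_class word_eval_closed)
next
  fix A B assume "A \<in> carrier (free_group X)" "B \<in> carrier (free_group X)"
  then obtain u v where "u \<in> lists (X \<times> UNIV)" "A = free_equiv X `` {u}"
    "v \<in> lists (X \<times> UNIV)" "B = free_equiv X `` {v}"
    by (metis free_group_cases)
  then show "free_lift H f (A \<otimes>\<^bsub>free_group X\<^esub> B) = free_lift H f A \<otimes>\<^bsub>H\<^esub> free_lift H f B"
    using free_lift_class[of "u @ v"] by (simp add: free_group_mult free_lift_class word_eval_append)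
qed

lemma free_lift_gen: "a \<in> X \<Longrightarrow> free_lift H f (free_gen X a) = f a"
  using free_lift_class[of "[(a, True)]"] f by (simp add: free_gen_def word_eval_def Pi_iff)

end

lemma normal_closure_subset: "N \<lhd> G \<Longrightarrow> R \<subseteq> N \<Longrightarrow> normal_closure G R \<subseteq> N"
  by (auto simp: normal_closure_def)

lemma subset_normal_closure: "R \<subseteq> normal_closure G R"
  by (auto simp: normal_closure_def)

lemma (in group_hom) normal_closure_subset_kernel:
  assumes "R \<subseteq> carrier G" "\<And>r. r \<in> R \<Longrightarrow> h r = \<one>\<^bsub>H\<^esub>"
  shows "normal_closure G R \<subseteq> kernel G H h"
  using assms by (intro normal_closure_subset normal_kernel) (auto simp: kernel_def)

lemma (in normal) r_coset_eq_one_iff: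
  assumes "x \<in> carrier G"
  shows "H #> x = \<one>\<^bsub>G Mod H\<^esub> \<longleftrightarrow> x \<in> H"
  using coset_join1[OF _ assms is_subgroup] coset_join2[OF assms is_subgroup] subset
  by (auto simp: FactGroup_def)

lemma finitely_presentedI:
  assumes H: "group H" and \<alpha>: "\<alpha> \<in> hom (free_group {1..n::nat}) H"
    and onto: "\<alpha> ` carrier (free_group {1..n}) = carrier H"
    and R: "finite R" "R \<subseteq> carrier (free_group {1..n})"
    and ker: "kernel (free_group {1..n}) H \<alpha> = normal_closure (free_group {1..n}) R"
  shows "finitely_presented H"
proof -
  interpret \<alpha>: group_hom "free_group {1..n}" H \<alpha>
    using group_free_group H \<alpha> by (intro group_hom.intro group_hom_axioms.intro)
  have "presented_group {1..n} R \<cong> H"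
    using \<alpha>.FactGroup_iso[OF onto] by (simp only: presented_group_def ker)
  then show ?thesis using H R unfolding finitely_presented_def by blast
qed

section \<open>Periodic sequences with a shift\<close>

text \<open>For positive \<open>m\<close> this is the semidirect product of the
  \<open>m\<close>-fold power of \<open>G\<close> with the integers. Periodic functions on
  \<open>int\<close>, in place of functions on residues, keep the shift \<open>k + a\<close> free of
  reductions, and the second component can hold the full degree.\<close>

definition periodic_wreath :: "int \<Rightarrow> ('a, 'b) monoid_scheme \<Rightarrow> ((int \<Rightarrow> 'a) \<times> int) monoid" where
  "periodic_wreath m G =
    \<lparr>carrier = {f. range f \<subseteq> carrier G \<and> (\<forall>k. f (k + m) = f k)} \<times> UNIV,
     mult = (\<lambda>(f, a) (g, b). (\<lambda>k. f k \<otimes>\<^bsub>G\<^esub> g (k + a), a + b)),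
     one = (\<lambda>_. \<one>\<^bsub>G\<^esub>, 0)\<rparr>"

lemma carrier_periodic_wreath:
  "x \<in> carrier (periodic_wreath m G) \<longleftrightarrow>
    (\<forall>k. fst x k \<in> carrier G) \<and> (\<forall>k. fst x (k + m) = fst x k)"
  by (cases x) (auto simp: periodic_wreath_def)

lemma fst_mult_periodic_wreath [simp]:
  "fst (x \<otimes>\<^bsub>periodic_wreath m G\<^esub> y) = (\<lambda>k. fst x k \<otimes>\<^bsub>G\<^esub> fst y (k + snd x))"
  by (cases x; cases y) (simp add: periodic_wreath_def)

lemma snd_mult_periodic_wreath [simp]: "snd (x \<otimes>\<^bsub>periodic_wreath m G\<^esub> y) = snd x + snd y"
  by (cases x; cases y) (simp add: periodic_wreath_def)

lemma one_periodic_wreath: "\<one>\<^bsub>periodic_wreath m G\<^esub> = (\<lambda>_. \<one>\<^bsub>G\<^esub>, 0)"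
  by (simp add: periodic_wreath_def)

lemma group_periodic_wreath:
  assumes "group G"
  shows "group (periodic_wreath m G)"
proof -
  interpret group G by fact
  have shift: "f (k + (m + a)) = f (k + a)" if "\<forall>k. f (k + m) = f k" for f :: "int \<Rightarrow> 'a" and k a
    using spec[OF that, of "k + a"] by (simp add: algebra_simps)
  show ?thesis
  proof (rule groupI)
    fix x assume x: "x \<in> carrier (periodic_wreath m G)"
    \<comment> \<open>A right factor is read at positions shifted by the second component of the
      left one, here \<open>- snd x\<close>; hence the same shift inside the inverse.\<close>
    let ?y = "(\<lambda>k. inv\<^bsub>G\<^esub> (fst x (k + - snd x)), - snd x)"
    have "?y \<in> carrier (periodic_wreath m G)"
      using x shift[of "fst x" _ "- snd x"] by (simp add: carrier_periodic_wreath add_diff_eq)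
    moreover have "?y \<otimes>\<^bsub>periodic_wreath m G\<^esub> x = \<one>\<^bsub>periodic_wreath m G\<^esub>"
      using x by (intro prod_eqI) (simp_all add: carrier_periodic_wreath one_periodic_wreath)
    ultimately show "\<exists>y\<in>carrier (periodic_wreath m G). y \<otimes>\<^bsub>periodic_wreath m G\<^esub> x = \<one>\<^bsub>periodic_wreath m G\<^esub>"
      by blast
  qed (auto simp: carrier_periodic_wreath one_periodic_wreath prod_eq_iff m_assoc shift add.assoc)
qed

lemma hom_periodic_wreath:
  assumes "h \<in> hom G H"
  shows "map_prod (\<lambda>f. h \<circ> f) id \<in> hom (periodic_wreath m G) (periodic_wreath m H)"
  using assms
  by (intro homI) (auto simp: carrier_periodic_wreath prod_eq_iff hom_mult intro: hom_in_carrier)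

lemma periodic_wreath_mod:
  assumes "x \<in> carrier (periodic_wreath m G)"
  shows "fst x (k mod m) = fst x k"
proof -
  have nat: "fst x (k + int j * m) = fst x k" for k j
  proof (induction j)
    case (Suc j)
    then show ?case
      using assms spec[of "\<lambda>k. fst x (k + m) = fst x k" "k + int j * m"]
      by (simp add: carrier_periodic_wreath algebra_simps)
  qed simp
  show ?thesis
  proof (cases "0 \<le> k div m")
    case True
    then show ?thesis using nat[of "k mod m" "nat (k div m)"] by simp
  next
    case False
    \<comment> \<open>The fact \<open>nat\<close> only adds nonnegative multiples of
      \<open>m\<close>, so for a negative quotient it is applied from \<open>k\<close> towards
      \<open>k mod m\<close>.\<close>
    have "k + int (nat (- (k div m))) * m = k mod m"
      using False by (simp add: minus_mult_div_eq_mod[symmetric] algebra_simps)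
    then show ?thesis using nat[of k "nat (- (k div m))"] by simp
  qed
qed

section \<open>The kernel of the degree in a group with a central element of positive degree\<close>

text \<open>Nothing specific to C-groups remains: only the degree of the generators and one central
  element of positive degree matter. The element \<open>z\<close> is kept in the free group because
  it is rewritten into relators together with \<open>R\<close>.\<close>

locale cyclic_graded_presentation =
  fixes n m :: nat and R :: "nat word set set" and G :: "('g, 'b) monoid_scheme" (structure)
    and \<pi> :: "nat word set \<Rightarrow> 'g" and deg :: "'g \<Rightarrow> int" and z :: "nat word set"
  assumes G: "group G" and n: "1 \<le> n" and m: "1 \<le> m"
    and R: "finite R" "R \<subseteq> carrier (free_group {1..n})"
    and \<pi>: "\<pi> \<in> hom (free_group {1..n}) G"
    and onto: "\<pi> ` carrier (free_group {1..n}) = carrier G"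
    and ker: "kernel (free_group {1..n}) G \<pi> = normal_closure (free_group {1..n}) R"
    and deg: "deg \<in> hom G integer_group"
    and deg_gen: "i \<in> {1..n} \<Longrightarrow> deg (\<pi> (free_gen {1..n} i)) = 1"
    and z: "z \<in> carrier (free_group {1..n})" and deg_z: "deg (\<pi> z) = int m"
    and central: "g \<in> carrier G \<Longrightarrow> \<pi> z \<otimes> g = g \<otimes> \<pi> z"
begin

section \<open>Rewriting data: numbering of the new generators, transversal, and the maps \<sigma>
  and \<theta>\<close>

definition F where "F = free_group {1..n}"
definition x where "x = free_gen {1..n}"
definition F' where "F' = free_group {1..n * m}"
definition x' where "x' = free_gen {1..n * m}"

lemma group_F: "group F" and group_F': "group F'"
  by (simp_all only: F_def F'_def group_free_group)

sublocale G: group G by (rule G)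
sublocale F: group F by (rule group_F)
sublocale F': group F' by (rule group_F')
sublocale \<pi>: group_hom F G \<pi>
  using \<pi> by unfold_locales (simp only: F_def)
sublocale deg: group_hom G integer_group deg
  using deg by (intro group_hom.intro group_hom_axioms.intro) (simp_all add: G)

lemma x_carrier: "i \<in> {1..n} \<Longrightarrow> x i \<in> carrier F"
  unfolding x_def F_def by (rule free_gen_carrier)

lemma x'_carrier: "y \<in> {1..n * m} \<Longrightarrow> x' y \<in> carrier F'"
  unfolding x'_def F'_def by (rule free_gen_carrier)

lemma zF: "z \<in> carrier F" using z by (simp only: F_def)

lemma x1: "x 1 \<in> carrier F" using n by (intro x_carrier) simp

text \<open>\<open>finitely_presented\<close> wants generators numbered from 1, so pairs of an index
  and a residue are enumerated. Reducing \<open>k\<close> inside makes \<open>code i\<close>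
  periodic on all integers, as membership in \<open>periodic_wreath\<close> demands.\<close>

definition code :: "nat \<Rightarrow> int \<Rightarrow> nat" where
  "code i k = nat (k mod int m) * n + i"

lemma code_mem:
  assumes "i \<in> {1..n}"
  shows "code i k \<in> {1..n * m}"
proof -
  have "nat (k mod int m) < m" using m by (simp add: nat_less_iff)
  then have "Suc (nat (k mod int m)) * n \<le> m * n" by (intro mult_le_mono1) simp
  then show ?thesis using assms by (simp add: code_def algebra_simps)
qed

lemma code_period: "code i (k + int m) = code i k"
  by (simp add: code_def)

lemma code_cases:
  assumes "y \<in> {1..n * m}"
  obtains i k where "i \<in> {1..n}" "0 \<le> k" "k < int m" "y = code i k"
proof
  show "(y - 1) mod n + 1 \<in> {1..n}" using n by (simp add: Suc_le_eq)
  have "(y - 1) div n < m" using assms n by (auto simp: div_less_iff_less_mult mult.commute)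
  then show "int ((y - 1) div n) < int m" by simp
  then show "y = code ((y - 1) mod n + 1) (int ((y - 1) div n))"
    using assms by (simp add: code_def)
qed simp

lemma code_decode:
  assumes "i \<in> {1..n}"
  shows "(code i k - 1) mod n + 1 = i" "(code i k - 1) div n = nat (k mod int m)"
proof -
  \<comment> \<open>Indices start at 1; after subtracting 1, \<open>i - 1\<close> is a genuine
    remainder below \<open>n\<close>.\<close>
  have *: "code i k - 1 = (i - 1) + nat (k mod int m) * n" "i - 1 < n"
    using assms by (auto simp: code_def)
  have "(i - 1 + a * n) mod n = i - 1" "(i - 1 + a * n) div n = a" for a
    using *(2) by simp_all
  note this[of "nat (k mod int m)", folded *(1)]
  then show "(code i k - 1) mod n + 1 = i" "(code i k - 1) div n = nat (k mod int m)"
    using assms by (simp_all only:) simp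
qed

text \<open>Powers of \<open>x 1\<close> represent the degrees below \<open>m\<close>, and
  \<open>z\<close>, of degree \<open>m\<close>, accounts for the quotient. Thus \<open>p k\<close>
  has degree \<open>k\<close>, and raising \<open>k\<close> by \<open>m\<close> costs just a factor
  \<open>z\<close>, which is central in \<open>G\<close>.\<close>

definition p :: "int \<Rightarrow> nat word set" where
  "p k = x 1 [^]\<^bsub>F\<^esub> (k mod int m) \<otimes>\<^bsub>F\<^esub> z [^]\<^bsub>F\<^esub> (k div int m)"

text \<open>On the generators of \<open>F'\<close> the decoded \<open>k\<close> satisfies
  \<open>0 \<le> k < m\<close>. For \<open>k = m - 1\<close> the last factor inverts
  \<open>p m\<close>, which is \<open>z\<close> and not \<open>p 0\<close>; so every value has
  degree 0.\<close>

definition \<sigma> :: "nat word set \<Rightarrow> nat word set" where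
  "\<sigma> = free_lift F (\<lambda>y. let k = int ((y - 1) div n) in
     p k \<otimes>\<^bsub>F\<^esub> x ((y - 1) mod n + 1) \<otimes>\<^bsub>F\<^esub> inv\<^bsub>F\<^esub> p (k + 1))"

definition \<theta> :: "nat word set \<Rightarrow> (int \<Rightarrow> nat word set) \<times> int" where
  "\<theta> = free_lift (periodic_wreath (int m) F') (\<lambda>i. (\<lambda>k. x' (code i k), 1))"

lemma p_carrier [simp]: "p k \<in> carrier F"
  using x1 zF by (simp add: p_def)

lemma deg_pi_hom: "(\<lambda>u. deg (\<pi> u)) \<in> hom F integer_group"
  using hom_compose[OF \<pi>.homh deg.homh] by (simp only: comp_def)

sublocale deg_pi: group_hom F integer_group "\<lambda>u. deg (\<pi> u)"
  by unfold_locales (rule deg_pi_hom)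

lemma deg_x: "i \<in> {1..n} \<Longrightarrow> deg (\<pi> (x i)) = 1"
  unfolding x_def by (rule deg_gen)

lemma deg_p: "deg (\<pi> (p k)) = k"
proof -
  have "deg (\<pi> (x 1)) = 1" using deg_x[of 1] n by simp
  then show ?thesis
    using x1 zF deg_z deg_pi.hom_int_pow[of "x 1"] deg_pi.hom_int_pow[of z]
    by (simp add: p_def deg_pi.hom_mult del: \<pi>.hom_mult deg.hom_mult One_nat_def)
qed

lemma \<sigma>_hom: "\<sigma> \<in> hom F' F"
  unfolding \<sigma>_def F'_def
  using n by (intro free_lift_hom F.is_group) (auto simp: Let_def intro!: F.m_closed F.inv_closed x_carrier simp: Suc_le_eq)

sublocale \<sigma>: group_hom F' F \<sigma> by unfold_locales (rule \<sigma>_hom)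

lemma \<sigma>_code:
  assumes "i \<in> {1..n}"
  shows "\<sigma> (x' (code i k)) = p (k mod int m) \<otimes>\<^bsub>F\<^esub> x i \<otimes>\<^bsub>F\<^esub> inv\<^bsub>F\<^esub> p (k mod int m + 1)"
proof -
  let ?f = "\<lambda>y. let k = int ((y - 1) div n) in
     p k \<otimes>\<^bsub>F\<^esub> x ((y - 1) mod n + 1) \<otimes>\<^bsub>F\<^esub> inv\<^bsub>F\<^esub> p (k + 1)"
  have "?f \<in> {1..n * m} \<rightarrow> carrier F"
    using n by (auto simp: Let_def intro!: F.m_closed F.inv_closed x_carrier simp: Suc_le_eq)
  then have "\<sigma> (x' (code i k)) = ?f (code i k)"
    unfolding \<sigma>_def x'_def using code_mem[OF assms] by (intro free_lift_gen F.is_group)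
  then show ?thesis using m by (simp only: Let_def code_decode[OF assms]) simp
qed

abbreviation W where "W \<equiv> periodic_wreath (int m) F'"

lemma group_W: "group W" by (rule group_periodic_wreath[OF group_F'])
sublocale W: group W by (rule group_W)

lemma \<theta>_img: "(\<lambda>i. (\<lambda>k. x' (code i k), 1)) \<in> {1..n} \<rightarrow> carrier W"
  using x'_carrier code_mem by (auto simp: carrier_periodic_wreath code_period)

lemma \<theta>_hom: "\<theta> \<in> hom F W"
  unfolding \<theta>_def F_def by (rule free_lift_hom[OF group_W \<theta>_img])

sublocale \<theta>: group_hom F W \<theta> by unfold_locales (rule \<theta>_hom)

lemma \<theta>_x: "i \<in> {1..n} \<Longrightarrow> \<theta> (x i) = (\<lambda>k. x' (code i k), 1)"
  unfolding \<theta>_def x_def by (rule free_lift_gen[OF group_W \<theta>_img])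

lemma \<theta>_carrier: "u \<in> carrier F \<Longrightarrow> fst (\<theta> u) k \<in> carrier F'"
  using \<theta>.hom_closed by (simp add: carrier_periodic_wreath)

lemma snd_hom: "snd \<in> hom (periodic_wreath k K) integer_group"
  by (rule homI) auto

lemma snd_\<theta>:
  assumes "u \<in> carrier F"
  shows "snd (\<theta> u) = deg (\<pi> u)"
proof -
  have "(snd \<circ> \<theta>) u = deg (\<pi> u)"
  proof (rule free_group_hom_eqI[where X = "{1..n}"])
    show "snd \<circ> \<theta> \<in> hom (free_group {1..n}) integer_group"
      using hom_compose[OF \<theta>_hom snd_hom] by (simp only: F_def)
    show "(\<lambda>u. deg (\<pi> u)) \<in> hom (free_group {1..n}) integer_group"
      using deg_pi_hom by (simp only: F_def)
    fix i assume "i \<in> {1..n}"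
    then show "(snd \<circ> \<theta>) (free_gen {1..n} i) = deg (\<pi> (free_gen {1..n} i))"
      using \<theta>_x deg_x by (simp only: x_def[symmetric] o_apply snd_conv)
  qed (use assms in \<open>simp_all add: F_def\<close>)
  then show ?thesis by simp
qed

section \<open>The transversal in \<open>G\<close> and the map \<alpha> from \<open>F'\<close> to
  \<open>G\<close>\<close>

definition P where "P k = \<pi> (p k)"
definition Z where "Z = \<pi> z"

lemma P_carrier [simp]: "P k \<in> carrier G" by (simp add: P_def)
lemma Z_carrier [simp]: "Z \<in> carrier G" using zF by (simp add: Z_def)

lemma P_add_mult: "P (k + int m * q) = P k \<otimes> Z [^] q"
proof -
  have k: "(k + int m * q) div int m = k div int m + q" "(k + int m * q) mod int m = k mod int m"
    using m by simp_all
  show ?thesis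
    unfolding P_def p_def k
    using x1 zF by (simp add: Z_def \<pi>.hom_int_pow G.int_pow_mult G.m_assoc)
qed

lemma Z_pow_central: "Z [^] q \<otimes> g = g \<otimes> Z [^] q"
  if g: "g \<in> carrier G" for q :: int
proof -
  have nat: "Z [^] j \<otimes> g = g \<otimes> Z [^] j" for j :: nat
    by (rule G.group_commutes_pow[OF central[OF g, folded Z_def] Z_carrier g])
  have inv: "inv (Z [^] j) \<otimes> g = g \<otimes> inv (Z [^] j)" for j :: nat
  proof -
    have "inv (Z [^] j) \<otimes> g = inv (Z [^] j) \<otimes> (g \<otimes> Z [^] j) \<otimes> inv (Z [^] j)"
      using g by (simp add: G.m_assoc)
    also have "\<dots> = inv (Z [^] j) \<otimes> (Z [^] j \<otimes> g) \<otimes> inv (Z [^] j)"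
      by (simp only: nat)
    also have "\<dots> = g \<otimes> inv (Z [^] j)"
      using g by (simp flip: G.m_assoc)
    finally show ?thesis .
  qed
  show ?thesis
    unfolding int_pow_def2 using nat[of "nat q"] inv[of "nat (- q)"] by (cases "q < 0") (simp_all only: if_True if_False)
qed

text \<open>Both indices change by the same multiple of \<open>m\<close>, which inserts a power of
  \<open>Z\<close> on the left of \<open>g\<close> and its inverse on the right. They cancel because
  \<open>Z\<close> is central.\<close>

lemma P_mod:
  assumes "g \<in> carrier G"
  shows "P (k mod int m) \<otimes> g \<otimes> inv (P (k mod int m + a)) = P k \<otimes> g \<otimes> inv (P (k + a))"
proof -
  define q where "q = k div int m"
  define b where "b = inv (P (k mod int m + a))"
  have b: "b \<in> carrier G" by (simp add: b_def)
  have k: "k = k mod int m + int m * q" "k + a = (k mod int m + a) + int m * q" by (simp_all add: q_def)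
  have "P k = P (k mod int m) \<otimes> Z [^] q" "P (k + a) = P (k mod int m + a) \<otimes> Z [^] q"
    using P_add_mult k by metis+
  then have "P k \<otimes> g \<otimes> inv (P (k + a)) = P (k mod int m) \<otimes> Z [^] q \<otimes> g \<otimes> (inv (Z [^] q) \<otimes> b)"
    by (simp add: b_def G.inv_mult_group)
  also have "\<dots> = P (k mod int m) \<otimes> (g \<otimes> Z [^] q) \<otimes> (inv (Z [^] q) \<otimes> b)"
    using assms by (simp add: Z_pow_central G.m_assoc)
  also have "\<dots> = P (k mod int m) \<otimes> g \<otimes> (Z [^] q \<otimes> inv (Z [^] q)) \<otimes> b"
    using assms b by (simp only: G.m_assoc G.m_closed G.inv_closed G.int_pow_closed P_carrier Z_carrier)
  also have "\<dots> = P (k mod int m) \<otimes> g \<otimes> b"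
    using assms b by simp
  also have "\<dots> = P (k mod int m) \<otimes> g \<otimes> inv (P (k mod int m + a))"
    by (simp only: b_def)
  finally show ?thesis ..
qed

definition \<alpha> where "\<alpha> = \<pi> \<circ> \<sigma>"

lemma \<alpha>_hom: "\<alpha> \<in> hom F' G"
  unfolding \<alpha>_def by (rule hom_compose[OF \<sigma>_hom \<pi>.homh])

sublocale \<alpha>: group_hom F' G \<alpha> by unfold_locales (rule \<alpha>_hom)

lemma \<alpha>_code:
  assumes "i \<in> {1..n}"
  shows "\<alpha> (x' (code i k)) = P k \<otimes> \<pi> (x i) \<otimes> inv (P (k + 1))"
  using assms x_carrier[OF assms] P_mod[of "\<pi> (x i)" k 1]
  by (simp add: \<alpha>_def \<sigma>_code P_def)

lemma P_period: "P (k + int m) \<otimes> g \<otimes> inv (P (k + int m + a)) = P k \<otimes> g \<otimes> inv (P (k + a))"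
  if "g \<in> carrier G"
  using P_mod[OF that, of "k + int m" a] P_mod[OF that, of k a] by simp

text \<open>Rewriting from the coset \<open>k\<close> followed by \<alpha> gives back the element up
  to transversal factors. Both sides are first components of homomorphisms into the periodic
  sequences over \<open>G\<close>, and \<open>\<alpha>_code\<close> is the case of a
  generator.\<close>

lemma \<alpha>_\<theta>:
  assumes "u \<in> carrier F"
  shows "\<alpha> (fst (\<theta> u) k) = P k \<otimes> \<pi> u \<otimes> inv (P (k + deg (\<pi> u)))"
proof -
  let ?W = "periodic_wreath (int m) G"
  let ?\<Psi> = "\<lambda>u. (\<lambda>k. P k \<otimes> \<pi> u \<otimes> inv (P (k + deg (\<pi> u))), deg (\<pi> u))"
  have "(map_prod (\<lambda>f. \<alpha> \<circ> f) id \<circ> \<theta>) u = ?\<Psi> u"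
  proof (rule free_group_hom_eqI[where X = "{1..n}" and H = ?W])
    show "group ?W" by (rule group_periodic_wreath[OF G])
    show "map_prod (\<lambda>f. \<alpha> \<circ> f) id \<circ> \<theta> \<in> hom (free_group {1..n}) ?W"
      using hom_compose[OF \<theta>_hom hom_periodic_wreath[OF \<alpha>_hom]] by (simp only: F_def)
    have "?\<Psi> \<in> hom F ?W"
    proof (rule homI)
      fix u assume "u \<in> carrier F"
      then show "?\<Psi> u \<in> carrier ?W" by (simp add: carrier_periodic_wreath P_period)
    next
      fix u v assume uv: "u \<in> carrier F" "v \<in> carrier F"
      \<comment> \<open>Multiplicativity is telescoping: the transversal element closing the factor
        of \<open>u\<close> opens the shifted factor of \<open>v\<close>.\<close>
      have "P k \<otimes> (\<pi> u \<otimes> \<pi> v) \<otimes> inv (P (k + (deg (\<pi> u) + deg (\<pi> v)))) =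
          P k \<otimes> \<pi> u \<otimes> inv (P (k + deg (\<pi> u))) \<otimes>
          (P (k + deg (\<pi> u)) \<otimes> \<pi> v \<otimes> inv (P (k + deg (\<pi> u) + deg (\<pi> v))))" for k
      proof -
        have "inv (P (k + deg (\<pi> u))) \<otimes> (P (k + deg (\<pi> u)) \<otimes> w) = w" if "w \<in> carrier G" for w
          using that by (simp add: G.m_assoc[symmetric])
        then show ?thesis using uv by (simp add: G.m_assoc add.assoc)
      qed
      then show "?\<Psi> (u \<otimes>\<^bsub>F\<^esub> v) = ?\<Psi> u \<otimes>\<^bsub>?W\<^esub> ?\<Psi> v"
        using uv by (simp add: prod_eq_iff)
    qed
    then show "?\<Psi> \<in> hom (free_group {1..n}) ?W" by (simp only: F_def)
    fix i assume i: "i \<in> {1..n}"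
    have "(map_prod (\<lambda>f. \<alpha> \<circ> f) id \<circ> \<theta>) (x i) = ?\<Psi> (x i)"
      using \<theta>_x[OF i] \<alpha>_code[OF i] deg_x[OF i] by (simp add: fun_eq_iff)
    then show "(map_prod (\<lambda>f. \<alpha> \<circ> f) id \<circ> \<theta>) (free_gen {1..n} i) = ?\<Psi> (free_gen {1..n} i)"
      by (simp only: x_def)
  qed (use assms in \<open>simp add: F_def\<close>)
  then show ?thesis by (simp add: prod_eq_iff fun_eq_iff)
qed

section \<open>Surjectivity of \<alpha> onto the kernel of the degree, and the relators\<close>

definition N where "N = G\<lparr>carrier := kernel G integer_group deg\<rparr>"

lemma group_N: "group N"
  unfolding N_def by (intro subgroup.subgroup_is_group deg.subgroup_kernel G)

lemma deg_\<alpha>: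
  assumes "v \<in> carrier F'"
  shows "deg (\<alpha> v) = 0"
proof -
  have "(deg \<circ> \<alpha>) v = (\<lambda>_. 0) v"
  proof (rule free_group_hom_eqI[where X = "{1..n * m}" and H = integer_group])
    show "deg \<circ> \<alpha> \<in> hom (free_group {1..n * m}) integer_group"
      using hom_compose[OF \<alpha>_hom deg.homh] by (simp only: F'_def)
    show "(\<lambda>_. 0) \<in> hom (free_group {1..n * m}) integer_group" by (rule homI) auto
    fix y assume "y \<in> {1..n * m}"
    then obtain i k where i: "i \<in> {1..n}" and y: "y = code i k" by (rule code_cases)
    then have "(deg \<circ> \<alpha>) (x' y) = 0"
      using \<alpha>_code[OF i, of k] deg_x[OF i] deg_p x_carrier[OF i] by (simp add: P_def)
    then show "(deg \<circ> \<alpha>) (free_gen {1..n * m} y) = 0"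
      by (simp only: x'_def)
  qed (use assms in \<open>simp_all add: F'_def\<close>)
  then show ?thesis by simp
qed

lemma \<alpha>_onto: "\<alpha> ` carrier F' = carrier N"
proof
  show "\<alpha> ` carrier F' \<subseteq> carrier N"
    using deg_\<alpha> \<alpha>.hom_closed by (auto simp: N_def kernel_def)
  show "carrier N \<subseteq> \<alpha> ` carrier F'"
  proof
    fix g assume "g \<in> carrier N"
    then have g: "g \<in> carrier G" "deg g = 0" by (auto simp: N_def kernel_def)
    then obtain u where u: "u \<in> carrier F" "g = \<pi> u" using onto by (auto simp: F_def)
    \<comment> \<open>At the trivial coset, an element of degree 0 has both transversal factors
      trivial, so rewriting any lift of it yields a preimage.\<close>
    have "P 0 = \<one>" using x1 zF by (simp add: P_def p_def)
    then have "\<alpha> (fst (\<theta> u) 0) = g" using \<alpha>_\<theta>[OF u(1), of 0] u g by simp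
    then show "g \<in> \<alpha> ` carrier F'" using \<theta>_carrier[OF u(1)] by blast
  qed
qed

text \<open>The last family makes the transversal \<open>x\<^sub>1\<^sup>k\<close>, \<open>k < m\<close>, trivial.\<close>

definition S where
  "S = (\<lambda>(r, k). fst (\<theta> r) k) ` (insert z R \<times> {0..<int m}) \<union> (\<lambda>k. x' (code 1 k)) ` {0..<int m - 1}"

lemma S_finite: "finite S" using R by (simp add: S_def)

lemma S_carrier: "S \<subseteq> carrier F'"
  using R zF \<theta>_carrier code_mem[of 1] x'_carrier n by (auto simp: S_def F_def)

lemma \<pi>_R: "r \<in> R \<Longrightarrow> r \<in> carrier F \<and> \<pi> r = \<one>"
  using ker R subset_normal_closure[of R F] by (auto simp: kernel_def F_def)

text \<open>By \<open>\<alpha>_\<theta>\<close>, a relator gives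
  \<open>P k \<otimes> inv (P k)\<close>, and \<open>z\<close> gives the trivial element because
  \<open>P (k + m) = P k \<otimes> Z\<close>. The last family is trivial because consecutive
  transversal elements differ by \<open>x 1\<close>.\<close>

lemma \<alpha>_S:
  assumes "s \<in> S"
  shows "\<alpha> s = \<one>"
  using assms unfolding S_def
proof (elim UnE imageE SigmaE2)
  fix rk assume s: "s = (\<lambda>(r, k). fst (\<theta> r) k) rk" and rk: "rk \<in> insert z R \<times> {0..<int m}"
  obtain r k where [simp]: "rk = (r, k)" by (cases rk)
  show ?thesis
  proof (cases "r = z")
    case True
    have "P (k + int m) = P k \<otimes> Z" using P_add_mult[of k 1] by simp
    then show ?thesis using s True \<alpha>_\<theta>[OF zF, of k] deg_z by (simp add: Z_def[symmetric])
  next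
    case False
    then show ?thesis using s rk \<pi>_R[of r] \<alpha>_\<theta>[of r k] by simp
  qed
next
  fix k assume s: "s = x' (code 1 k)" and k: "k \<in> {0..<int m - 1}"
  \<comment> \<open>The bound \<open>k < m - 1\<close> keeps \<open>k + 1\<close> below
    \<open>m\<close>, so no power of \<open>z\<close> enters \<open>p (k + 1)\<close>.\<close>
  have "P k \<otimes> \<pi> (x 1) = P (k + 1)"
  proof -
    have "x 1 [^]\<^bsub>F\<^esub> (k + 1) = x 1 [^]\<^bsub>F\<^esub> k \<otimes>\<^bsub>F\<^esub> x 1" using x1 F.int_pow_mult[of "x 1" k 1] by simp
    then show ?thesis using k x1 by (simp add: P_def p_def flip: \<pi>.hom_mult)
  qed
  then show ?thesis using s \<alpha>_code[of 1 k] n by simp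
qed

section \<open>Rewriting modulo the relators as an inverse of \<alpha>\<close>

definition M where "M = normal_closure F' S"

lemma M_normal: "M \<lhd> F'"
  unfolding M_def by (rule normal_normal_closure[OF group_F' S_carrier])

definition q where "q v = M #>\<^bsub>F'\<^esub> v"

sublocale Q: group "F' Mod M" by (rule normal.factorgroup_is_group[OF M_normal])

lemma q_hom: "q \<in> hom F' (F' Mod M)"
  unfolding q_def using normal.r_coset_hom_Mod[OF M_normal] by simp

sublocale q: group_hom F' "F' Mod M" q by unfold_locales (rule q_hom)

lemma q_one_iff: "v \<in> carrier F' \<Longrightarrow> q v = \<one>\<^bsub>F' Mod M\<^esub> \<longleftrightarrow> v \<in> M"
  unfolding q_def by (rule normal.r_coset_eq_one_iff[OF M_normal])

lemma q_S: "s \<in> S \<Longrightarrow> q s = \<one>\<^bsub>F' Mod M\<^esub>"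
  using q_one_iff S_carrier subset_normal_closure[of S F'] by (auto simp: M_def)

abbreviation V where "V \<equiv> periodic_wreath (int m) (F' Mod M)"

sublocale V: group V by (rule group_periodic_wreath[OF Q.is_group])

definition \<tau> where "\<tau> = map_prod (\<lambda>f. q \<circ> f) id \<circ> \<theta>"

lemma \<tau>_hom: "\<tau> \<in> hom F V"
  unfolding \<tau>_def by (rule hom_compose[OF \<theta>_hom hom_periodic_wreath[OF q_hom]])

sublocale \<tau>: group_hom F V \<tau> by unfold_locales (rule \<tau>_hom)

lemma \<tau>_fst: "fst (\<tau> u) k = q (fst (\<theta> u) k)" and \<tau>_snd: "snd (\<tau> u) = snd (\<theta> u)"
  by (simp_all add: \<tau>_def)

text \<open>\<open>S\<close> lists only the entries with \<open>0 \<le> k < m\<close>; periodicity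
  supplies the others. Relators in \<open>R\<close> have degree 0 and die, whereas \<open>z\<close>
  becomes the pure shift by \<open>m\<close>.\<close>

lemma \<tau>_relator:
  assumes "r \<in> insert z R"
  shows "\<tau> r = (\<lambda>_. \<one>\<^bsub>F' Mod M\<^esub>, deg (\<pi> r))"
proof -
  have r: "r \<in> carrier F" using assms zF \<pi>_R by auto
  have "q (fst (\<theta> r) k) = \<one>\<^bsub>F' Mod M\<^esub>" for k
  proof -
    have "fst (\<theta> r) (k mod int m) \<in> S" using assms m by (auto simp: S_def)
    then show ?thesis using q_S periodic_wreath_mod[OF \<theta>.hom_closed[OF r]] by metis
  qed
  then show ?thesis using snd_\<theta>[OF r] by (simp add: prod_eq_iff \<tau>_fst \<tau>_snd fun_eq_iff)
qed

text \<open>Passing from \<open>j\<close> to \<open>Suc j\<close> multiplies entry 0 by the entry of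
  \<open>x 1\<close> at position \<open>j\<close>. This is a relator of the last family, as
  \<open>j < m - 1\<close> there.\<close>

lemma \<tau>_pow: "j < m \<Longrightarrow> fst (\<tau> (x 1 [^]\<^bsub>F\<^esub> j)) 0 = \<one>\<^bsub>F' Mod M\<^esub>"
proof (induction j)
  case 0
  then show ?case by (simp add: one_periodic_wreath)
next
  case (Suc j)
  have "deg (\<pi> (x 1 [^]\<^bsub>F\<^esub> j)) = int j"
    using x1 deg_x[of 1] n deg_pi.hom_nat_pow[of "x 1" j] by simp
  then have "snd (\<tau> (x 1 [^]\<^bsub>F\<^esub> j)) = int j" using x1 snd_\<theta> by (simp add: \<tau>_snd)
  moreover have "q (x' (code 1 (int j))) = \<one>\<^bsub>F' Mod M\<^esub>"
    using Suc by (intro q_S) (auto simp: S_def)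
  then have "fst (\<tau> (x 1)) (int j) = \<one>\<^bsub>F' Mod M\<^esub>"
    using \<theta>_x[of 1] n by (simp add: \<tau>_fst del: one_FactGroup)
  ultimately show ?case
    using Suc x1 by (simp del: mult_FactGroup one_FactGroup)
qed

text \<open>The upper end \<open>k = m\<close> is included because \<sigma> uses
  \<open>p (k + 1)\<close> up to \<open>k = m - 1\<close>; there the element is \<open>z\<close>
  itself.\<close>

lemma \<tau>_p:
  assumes "0 \<le> k" "k \<le> int m"
  shows "\<tau> (p k) = (fst (\<tau> (p k)), k)" "fst (\<tau> (p k)) 0 = \<one>\<^bsub>F' Mod M\<^esub>"
proof -
  show "\<tau> (p k) = (fst (\<tau> (p k)), k)" using deg_p snd_\<theta> by (simp add: prod_eq_iff \<tau>_snd)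
  show "fst (\<tau> (p k)) 0 = \<one>\<^bsub>F' Mod M\<^esub>"
  proof (cases "k = int m")
    case True
    then have "p k = z" using m zF by (simp add: p_def)
    then show ?thesis using \<tau>_relator[of z] by simp
  next
    case False
    then have "p k = x 1 [^]\<^bsub>F\<^esub> nat k" using assms x1 by (simp add: p_def flip: int_pow_int)
    then show ?thesis using \<tau>_pow[of "nat k"] False assms by simp
  qed
qed

text \<open>Values of \<sigma> have degree 0, so their images under \<tau> shift nothing and taking
  entry 0 is multiplicative. It remains to compare generators.\<close>

lemma \<tau>_\<sigma>:
  assumes "v \<in> carrier F'"
  shows "fst (\<tau> (\<sigma> v)) 0 = q v"
proof -
  have \<sigma>_snd: "snd (\<tau> (\<sigma> v)) = 0" if "v \<in> carrier F'" for v
    using that deg_\<alpha> snd_\<theta> by (simp add: \<tau>_snd \<alpha>_def)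
  have "(\<lambda>v. fst (\<tau> (\<sigma> v)) 0) v = q v"
  proof (rule free_group_hom_eqI[where X = "{1..n * m}" and H = "F' Mod M"])
    have "(\<lambda>v. fst (\<tau> (\<sigma> v)) 0) \<in> hom F' (F' Mod M)"
    proof (rule homI)
      fix v assume "v \<in> carrier F'"
      then show "fst (\<tau> (\<sigma> v)) 0 \<in> carrier (F' Mod M)"
        using \<tau>.hom_closed[of "\<sigma> v"] by (simp add: carrier_periodic_wreath)
    qed (use \<sigma>_snd in simp)
    then show "(\<lambda>v. fst (\<tau> (\<sigma> v)) 0) \<in> hom (free_group {1..n * m}) (F' Mod M)"
      by (simp only: F'_def)
    show "q \<in> hom (free_group {1..n * m}) (F' Mod M)"
      using q_hom by (simp only: F'_def)
    fix y assume y: "y \<in> {1..n * m}"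
    then obtain i k where i: "i \<in> {1..n}" and k: "0 \<le> k" "k < int m" and yk: "y = code i k"
      by (rule code_cases)
    define d where "d = \<sigma> (x' y)"
    have d: "d \<in> carrier F" using x'_carrier[OF y] by (simp add: d_def)
    have "d = p k \<otimes>\<^bsub>F\<^esub> x i \<otimes>\<^bsub>F\<^esub> inv\<^bsub>F\<^esub> p (k + 1)"
      using \<sigma>_code[OF i, of k] k by (simp add: d_def yk)
    \<comment> \<open>Clearing the inverse avoids inverting in \<open>V\<close>. In entry 0 both
      transversal elements contribute the identity, while \<open>p k\<close> shifts
      \<open>x i\<close> to position \<open>k\<close>, where the generator \<open>y\<close>
      sits.\<close>
    then have "d \<otimes>\<^bsub>F\<^esub> p (k + 1) = p k \<otimes>\<^bsub>F\<^esub> x i"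
      using x_carrier[OF i] by (simp add: F.m_assoc)
    then have "fst (\<tau> d \<otimes>\<^bsub>V\<^esub> \<tau> (p (k + 1))) 0 = fst (\<tau> (p k) \<otimes>\<^bsub>V\<^esub> \<tau> (x i)) 0"
      using d x_carrier[OF i] by (metis \<tau>.hom_mult p_carrier)
    moreover have "snd (\<tau> d) = 0" "snd (\<tau> (p k)) = k"
      using \<sigma>_snd[OF x'_carrier[OF y]] deg_p snd_\<theta> by (simp_all add: d_def \<tau>_snd)
    moreover have "fst (\<tau> d) 0 \<in> carrier (F' Mod M)"
      using \<tau>.hom_closed[OF d] by (simp add: carrier_periodic_wreath)
    moreover have "fst (\<tau> (x i)) k = q (x' y)"
      using \<theta>_x[OF i] by (simp add: \<tau>_fst yk)
    ultimately have "fst (\<tau> d) 0 = q (x' y)"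
      using \<tau>_p[of k] \<tau>_p[of "k + 1"] k x'_carrier[OF y]
      by (simp del: mult_FactGroup one_FactGroup)
    then show "fst (\<tau> (\<sigma> (free_gen {1..n * m} y))) 0 = q (free_gen {1..n * m} y)"
      by (simp only: d_def x'_def)
  qed (use assms Q.is_group in \<open>simp_all only: F'_def\<close>)
  then show ?thesis by simp
qed

text \<open>If \<alpha> kills \<open>v\<close>, then \<open>\<sigma> v\<close> lies in the normal
  closure of \<open>R\<close>, which \<tau> kills; entry 0 then shows that \<open>v\<close> is
  trivial modulo \<open>M\<close>.\<close>

lemma \<alpha>_kernel: "kernel F' N \<alpha> = M"
proof
  interpret \<alpha>N: group_hom F' N \<alpha>
    using group_N \<alpha>_hom \<alpha>_onto
    by (intro group_hom.intro group_hom_axioms.intro F'.is_group) (auto simp: hom_def N_def)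
  show "M \<subseteq> kernel F' N \<alpha>"
    unfolding M_def
    by (rule \<alpha>N.normal_closure_subset_kernel[OF S_carrier]) (simp add: \<alpha>_S N_def)
  have "normal_closure F R \<subseteq> kernel F V \<tau>"
    using \<pi>_R \<tau>_relator by (intro \<tau>.normal_closure_subset_kernel) (auto simp: one_periodic_wreath)
  then have \<tau>_ker: "\<tau> u = \<one>\<^bsub>V\<^esub>" if "u \<in> carrier F" "\<pi> u = \<one>" for u
    using that ker by (auto simp: kernel_def F_def)
  show "kernel F' N \<alpha> \<subseteq> M"
  proof
    fix v assume "v \<in> kernel F' N \<alpha>"
    then have v: "v \<in> carrier F'" "\<pi> (\<sigma> v) = \<one>" by (auto simp: kernel_def N_def \<alpha>_def)
    then have "\<tau> (\<sigma> v) = \<one>\<^bsub>V\<^esub>" using \<tau>_ker \<sigma>.hom_closed by blast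
    then have "q v = \<one>\<^bsub>F' Mod M\<^esub>"
      using \<tau>_\<sigma>[OF v(1)] by (simp only: one_periodic_wreath fst_conv)
    then show "v \<in> M" using q_one_iff v by blast
  qed
qed

theorem finitely_presented_kernel: "finitely_presented N"
proof (rule finitely_presentedI[OF group_N])
  show "\<alpha> \<in> hom (free_group {1..n * m}) N"
    using \<alpha>_hom \<alpha>_onto by (auto simp: hom_def N_def F'_def)
qed (use \<alpha>_onto \<alpha>_kernel S_finite S_carrier in \<open>simp_all only: F'_def M_def\<close>)

end


section \<open>The kernel of the natural C-homomorphism\<close>

lemma (in group_hom) hom_ordered_prod:
  assumes "set xs \<subseteq> carrier G"
  shows "ordered_prod G xs \<in> carrier G"
    and "h (ordered_prod G xs) = ordered_prod H (map h xs)"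
  using assms by (induction xs) (auto simp: ordered_prod_def)

lemma finite_C_relators: "finite (C_relators m h w)"
proof -
  \<comment> \<open>A nonpositive value of the integer-valued \<open>h\<close> just gives an empty
    interval.\<close>
  have "C_index m h = (\<lambda>((i, j), k). (i, j, k)) ` (SIGMA ij:{1..m} \<times> {1..m}. {1..h ij})"
    by (auto simp: C_index_def image_def)
  then have fin: "finite (C_index m h)" by simp
  have img: "{f i j k | i j k. (i, j, k) \<in> A} = (\<lambda>(i, j, k). f i j k) ` A"
    for f :: "nat \<Rightarrow> nat \<Rightarrow> int \<Rightarrow> nat word set" and A
    by (auto simp: image_def)
  show ?thesis
    unfolding C_relators_def Let_def img using fin by (rule finite_imageI)
qed

text \<open>The exponent is the exponent sum of \<open>u\<close>. This makes the exponent sum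
  injective, so that the kernel of \<nu> can be described by an integer degree.\<close>

lemma free_group_singleton_pow:
  assumes "u \<in> carrier (free_group {a})"
  shows "u = free_gen {a} a [^]\<^bsub>free_group {a}\<^esub> const_hom integer_group 1 u"
proof -
  interpret group "free_group {a}" by (rule group_free_group)
  have a: "free_gen {a} a \<in> carrier (free_group {a})" by (simp add: free_gen_carrier)
  let ?g = "(\<lambda>k::int. free_gen {a} a [^]\<^bsub>free_group {a}\<^esub> k) \<circ> const_hom integer_group 1"
  have "id u = ?g u"
  proof (rule free_group_hom_eqI[where X = "{a}" and H = "free_group {a}" and f = id and g = ?g])
    show "?g \<in> hom (free_group {a}) (free_group {a})"
      by (rule Group.hom_compose[OF const_hom_hom hom_integer_group_pow[OF a]]) simp_all
    fix b assume "b \<in> {a}"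
    then show "id (free_gen {a} b) = ?g (free_gen {a} b)"
      using const_hom_gen[of integer_group 1 a "{a}"] a by simp
  qed (use assms group_free_group in \<open>auto simp: hom_def\<close>)
  then show ?thesis by simp
qed

theorem theorem0p2:
  fixes G :: "('a, 'b) monoid_scheme" and C :: "'a set" and \<nu> :: "'a \<Rightarrow> nat word set"
  assumes "Hurwitz_C_group G C"
    and "natural_C_hom G C \<nu>"
  shows "finitely_presented (G\<lparr>carrier := kernel G F1 \<nu>\<rparr>)"
proof -
  have G: "group G" using assms(1) by (simp only: Hurwitz_C_group_def C_group_def)
  obtain m h w where pres: "has_C_presentation G C m h w"
    and central: "ordered_prod (C_presented_group m h w) (map (C_presented_gen m h w) [1..<Suc m])
        \<in> group_center (C_presented_group m h w)"
    using assms(1) unfolding Hurwitz_C_group_def by (elim conjE exE)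
  have P: "C_presentation m h w" using pres by (simp only: has_C_presentation_def)
  obtain f where f: "f \<in> C_iso (C_presented_group m h w) (C_presented_Cgens m h w) G C"
    using pres unfolding has_C_presentation_def by (metis ex_in_conv)
  define F where "F = free_group {1..m}"
  define x where "x = free_gen {1..m}"
  define R where "R = C_relators m h w"
  define K where "K = normal_closure F R"
  define q where "q = (\<lambda>u. K #>\<^bsub>F\<^esub> u)"
  define \<pi> where "\<pi> = f \<circ> q"
  define z where "z = ordered_prod F (map x [1..<Suc m])"
  \<comment> \<open>\<open>d\<close> is the exponent sum on \<open>F1\<close>; the degree on
    \<open>G\<close> will be \<open>d \<circ> \<nu>\<close>.\<close>
  define d :: "nat word set \<Rightarrow> int" where "d = const_hom integer_group 1"
  have R: "finite R" "R \<subseteq> carrier F"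
    unfolding R_def F_def by (rule finite_C_relators, rule C_relators_carrier[OF P])
  have groupF: "group F" unfolding F_def by (rule group_free_group)
  have K: "K \<lhd> F" unfolding K_def by (rule normal_normal_closure[OF groupF R(2)])
  define Q where "Q = F Mod K"
  have Q: "C_presented_group m h w = Q"
    by (simp only: C_presented_group_def presented_group_def Q_def K_def F_def R_def)
  have groupQ: "group Q" unfolding Q_def by (rule normal.factorgroup_is_group[OF K])
  have gen: "C_presented_gen m h w = (\<lambda>i. q (x i))"
    by (rule ext) (simp only: C_presented_gen_def presented_gen_def q_def K_def F_def R_def x_def)
  have xF: "x i \<in> carrier F" if "i \<in> {1..m}" for i
    unfolding x_def F_def using that by (rule free_gen_carrier)
  have "q \<in> hom F Q" unfolding q_def Q_def by (rule normal.r_coset_hom_Mod[OF K])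
  then interpret q: group_hom F Q q
    using groupF groupQ by (intro group_hom.intro group_hom_axioms.intro)
  have "f \<in> iso Q G" using f by (simp add: C_iso_def Q)
  then interpret f: group_hom Q G f
    using G groupQ by (intro group_hom.intro group_hom_axioms.intro) (auto simp: iso_def)
  have f_bij: "bij_betw f (carrier Q) (carrier G)" using \<open>f \<in> iso Q G\<close> by (simp add: iso_def)
  have "\<pi> \<in> hom F G" unfolding \<pi>_def by (rule hom_compose[OF q.homh f.homh])
  then interpret \<pi>: group_hom F G \<pi>
    using groupF G by (intro group_hom.intro group_hom_axioms.intro)
  have q_onto: "q ` carrier F = carrier Q"
    by (auto simp: q_def Q_def carrier_FactGroup)
  have onto: "\<pi> ` carrier F = carrier G"
    using f_bij by (simp only: \<pi>_def image_comp[symmetric] q_onto bij_betw_def)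
  have ker: "kernel F G \<pi> = K"
  proof -
    have "\<pi> u = \<one>\<^bsub>G\<^esub> \<longleftrightarrow> q u = \<one>\<^bsub>Q\<^esub>" if "u \<in> carrier F" for u
      using f_bij that f.hom_one inj_onD[OF bij_betw_imp_inj_on[OF f_bij], of "q u" "\<one>\<^bsub>Q\<^esub>"]
      by (auto simp: \<pi>_def)
    moreover have "q u = \<one>\<^bsub>Q\<^esub> \<longleftrightarrow> u \<in> K" if "u \<in> carrier F" for u
      unfolding q_def Q_def by (rule normal.r_coset_eq_one_iff[OF K that])
    moreover have "K \<subseteq> carrier F"
      using subgroup.subset[OF normal_imp_subgroup[OF K]] .
    ultimately show ?thesis by (auto simp: kernel_def)
  qed
  \<comment> \<open>The values of \<nu> are prescribed on \<open>C\<close> only, so the generators,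
    as conjugates by the identity, must first be placed there.\<close>
  have \<pi>_x: "\<pi> (x i) \<in> C" if i: "i \<in> {1..m}" for i
  proof -
    have "q (x i) \<in> conjugates Q ((\<lambda>i. q (x i)) ` {1..m})"
      unfolding conjugates_def
      using i xF[OF i] by (intro CollectI exI[of _ "\<one>\<^bsub>Q\<^esub>"] exI[of _ "q (x i)"]) simp
    then show ?thesis
      using f unfolding C_iso_def C_hom_def C_presented_Cgens_def Q gen by (auto simp: \<pi>_def)
  qed
  have d_hom: "d \<in> hom F1 integer_group"
    unfolding d_def by (rule const_hom_hom) simp_all
  have d_gen: "d (free_gen {1} 1) = 1"
    unfolding d_def by (rule const_hom_gen) simp_all
  have \<nu>: "\<nu> \<in> hom G F1" "\<And>c. c \<in> C \<Longrightarrow> \<nu> c = free_gen {1} 1"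
    using assms(2) by (simp_all only: natural_C_hom_def)
  have deg_hom: "d \<circ> \<nu> \<in> hom G integer_group" by (rule hom_compose[OF \<nu>(1) d_hom])
  have deg_x: "(d \<circ> \<nu>) (\<pi> (x i)) = 1" if "i \<in> {1..m}" for i
    by (simp only: o_apply \<nu>(2)[OF \<pi>_x[OF that]] d_gen)
  have xs: "set (map x [1..<Suc m]) \<subseteq> carrier F" using xF by auto
  interpret deg\<pi>: group_hom F integer_group "(d \<circ> \<nu>) \<circ> \<pi>"
    using groupF hom_compose[OF \<pi>.homh deg_hom]
    by (intro group_hom.intro group_hom_axioms.intro) simp_all
  have "((d \<circ> \<nu>) \<circ> \<pi>) z = ordered_prod integer_group (map (\<lambda>_. 1) [1..<Suc m])"
    unfolding z_def deg\<pi>.hom_ordered_prod(2)[OF xs] map_map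
    by (rule arg_cong[of _ _ "ordered_prod integer_group"], rule map_cong) (use deg_x in auto)
  also have "ordered_prod integer_group (map (\<lambda>_. 1) l) = int (length l)" for l :: "nat list"
    by (induction l) (simp_all add: ordered_prod_def)
  finally have deg_z: "(d \<circ> \<nu>) (\<pi> z) = int m" by simp
  have qz: "q z \<in> group_center Q"
    using central q.hom_ordered_prod(2)[OF xs] by (simp add: Q gen z_def comp_def)
  \<comment> \<open>Centrality is assumed in the presented group and carried to \<open>G\<close> by
    the isomorphism \<open>f\<close>.\<close>
  have \<pi>z: "\<pi> z \<otimes>\<^bsub>G\<^esub> g = g \<otimes>\<^bsub>G\<^esub> \<pi> z" if "g \<in> carrier G" for g
  proof -
    have "g \<in> f ` carrier Q" using that by (simp only: bij_betw_imp_surj_on[OF f_bij])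
    then obtain y where y: "g = f y" "y \<in> carrier Q" by (rule imageE)
    note qz' = qz[unfolded group_center_def mem_Collect_eq]
    have "q z \<otimes>\<^bsub>Q\<^esub> y = y \<otimes>\<^bsub>Q\<^esub> q z" "q z \<in> carrier Q"
      using bspec[OF conjunct2[OF qz'] y(2)] conjunct1[OF qz'] .
    then have "f (q z) \<otimes>\<^bsub>G\<^esub> f y = f y \<otimes>\<^bsub>G\<^esub> f (q z)"
      using f.hom_mult[of "q z" y] f.hom_mult[of y "q z"] y(2) by simp
    then show ?thesis by (simp only: y(1) \<pi>_def o_apply)
  qed
  \<comment> \<open>The number of generators and the degree of \<open>z\<close> agree, since each
    generator occurs once in \<open>z\<close>.\<close>
  interpret cyclic_graded_presentation m m R G \<pi> "d \<circ> \<nu>" z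
  proof
    show "z \<in> carrier (free_group {1..m})"
      using q.hom_ordered_prod(1)[OF xs] by (simp only: z_def F_def)
    show "\<pi> z \<otimes>\<^bsub>G\<^esub> g = g \<otimes>\<^bsub>G\<^esub> \<pi> z" if "g \<in> carrier G" for g
      using that by (rule \<pi>z)
  qed (use P G R \<pi>.homh onto ker deg_hom deg_x deg_z in
      \<open>simp_all only: C_presentation_def F_def K_def x_def\<close>)
  have "\<nu> g = \<one>\<^bsub>F1\<^esub> \<longleftrightarrow> d (\<nu> g) = 0" if "g \<in> carrier G" for g
  proof
    assume "\<nu> g = \<one>\<^bsub>F1\<^esub>"
    then show "d (\<nu> g) = 0" using hom_one[OF d_hom group_free_group] by simp
  next
    assume "d (\<nu> g) = 0"
    then show "\<nu> g = \<one>\<^bsub>F1\<^esub>"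
      using free_group_singleton_pow[OF hom_in_carrier[OF \<nu>(1) that]] by (simp add: d_def)
  qed
  then have "kernel G F1 \<nu> = kernel G integer_group (d \<circ> \<nu>)" by (auto simp: kernel_def)
  then show ?thesis using finitely_presented_kernel by (simp add: N_def)
qed

end
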